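(* Let $\varphi_2:\mathbb{N}\to\mathbb{N}$ be the function defined as follows. The values $\varphi_2(0),\varphi_2(1),\dots,\varphi_2(29)$ are, in order, $$1,0,2,4,3,6,5,7,8,9,\ 10,11,12,13,18,19,20,21,14,15,\ 16,17,26,27,28,29,22,23,24,25.$$ (1) If either $30\le x<56$ or $7\cdot 2^{2n}\le x<7\cdot 2^{2n+1}$ for some integer $n\ge 2$, then $\varphi_2(x)=x$. (2) If $7\cdot 2^{2n-1}\le x<7\cdot 2^{2n}$ for some integer $n\ge2$, then $\varphi_2(x)=x\oplus 2$. Then, for all nonnegative integers $a,b$, the Halve Nim position $a^1b^12^1$ is a $\mathcal{P}$-position if and only if $b=\varphi_2(a)$. Furthermore, for $a,b\ge 30$, $a^1b^12^1$ is a $\mathcal{P}$-position if and only if $$a\oplus b=1+(-1)^{\lfloor\log_2(a/7)\rfloor+1}.$$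
   Context: $\mathbb{N}$ is the set of nonnegative integers and $\oplus$ denotes bitwise XOR. Halve Nim is a two-player game played on finitely many piles of coins; players alternate moves and a player who cannot move loses. A move is one of: (i) choose one pile and remove at least one coin from it; (ii) halve the game: simultaneously replace every pile of $m$ coins by a pile of $\lfloor m/2\rfloor$ coins. When there are no coins left, no move is available (halving requires at least one coin to be present). A position is a $\mathcal{P}$-position if the player who is not about to move has a winning strategy (equivalently, every move from it leads to an $\mathcal{N}$-position), and an $\mathcal{N}$-position if the player about to move has a winning strategy. $a^1b^1c^1$ denotes the position with three piles of sizes $a$, $b$, $c$ (a pile of size $0$ is an empty pile); in particular $a^1b^12^1$ has piles of sizes $a$, $b$, $2$. *)

theory Defs
  imports Complex_Main "HOL-Library.Multiset"
begin

text \<open>Empty piles may be listed; no move acts on them alone.\<close>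

type_synonym position = "nat multiset"

inductive halve_nim_move :: "position \<Rightarrow> position \<Rightarrow> bool" where
  remove: "m \<in># p \<Longrightarrow> k < m \<Longrightarrow> halve_nim_move p (add_mset k (p - {#m#}))"
| halve: "\<exists>m. m \<in># p \<and> 0 < m \<Longrightarrow> halve_nim_move p (image_mset (\<lambda>m. m div 2) p)"

text \<open>A derivation of either predicate is a winning strategy: for the player who has just
  moved in the first case, for the player about to move in the second.\<close>

inductive P_position :: "position \<Rightarrow> bool" and N_position :: "position \<Rightarrow> bool" where
  P_positionI: "(\<And>q. halve_nim_move p q \<Longrightarrow> N_position q) \<Longrightarrow> P_position p"
| N_positionI: "halve_nim_move p q \<Longrightarrow> P_position q \<Longrightarrow> N_position p"

lemma P_position_iff: "P_position p \<longleftrightarrow> (\<forall>q. halve_nim_move p q \<longrightarrow> N_position q)"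
  by (subst P_position.simps) simp

lemma N_position_iff: "N_position p \<longleftrightarrow> (\<exists>q. halve_nim_move p q \<and> P_position q)"
  by (subst N_position.simps) simp

lemma halve_nim_move_decreases: "halve_nim_move p q \<Longrightarrow> sum_mset q < sum_mset p"
proof (induction rule: halve_nim_move.induct)
  case (remove m p k)
  then show ?case
    by (auto dest!: multi_member_split)
next
  case (halve p)
  then obtain m r where p: "p = add_mset m r" and m: "0 < m"
    by (meson multi_member_split)
  have "(\<Sum>x\<in>#r. x div 2) \<le> sum_mset r"
    by (induction r) (auto intro!: add_mono)
  moreover have "m div 2 < m" using m by simp
  ultimately show ?case by (simp add: p)
qed

lemma P_position_iff_not_N_position: "P_position p \<longleftrightarrow> \<not> N_position p"
proof (induction "sum_mset p" arbitrary: p rule: less_induct)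
  case less
  then show ?case
    by (metis P_position_iff N_position_iff halve_nim_move_decreases)
qed

definition phi2 :: "nat \<Rightarrow> nat" where
  "phi2 x =
    (if x < 30 then
       [1, 0, 2, 4, 3, 6, 5, 7, 8, 9, 10, 11, 12, 13, 18, 19, 20, 21, 14, 15,
        16, 17, 26, 27, 28, 29, 22, 23, 24, 25] ! x
     else if x < 56 \<or> (\<exists>n\<ge>2. 7 * 2 ^ (2 * n) \<le> x \<and> x < 7 * 2 ^ (2 * n + 1)) then x
     else xor x 2)"

text \<open>The last branch is reached exactly on the intervals
  \<open>7 * 2 ^ (2 * n - 1) \<le> x < 7 * 2 ^ (2 * n)\<close> with \<open>n \<ge> 2\<close>.\<close>

lemma phi2_dyadic_interval:
  fixes x :: nat
  assumes "56 \<le> x"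
  obtains k where "3 \<le> k" "7 * 2 ^ k \<le> x" "x < 7 * 2 ^ (k + 1)"
proof -
  define k where "k = (GREATEST k. 7 * 2 ^ k \<le> x)"
  have bound: "k \<le> x" if "7 * 2 ^ k \<le> x" for k :: nat
    using that less_exp[of k] by linarith
  have three: "7 * 2 ^ 3 \<le> x" using assms by simp
  have "7 * 2 ^ k \<le> x" "3 \<le> k"
    unfolding k_def
    using GreatestI_nat[where P = "\<lambda>k. 7 * 2 ^ k \<le> x", OF three] bound
      Greatest_le_nat[where P = "\<lambda>k. 7 * 2 ^ k \<le> x", OF three] by blast+
  moreover have "x < 7 * 2 ^ (k + 1)"
    using Greatest_le_nat[where P = "\<lambda>k. 7 * 2 ^ k \<le> x" and k = "k + 1" and b = x] bound
    unfolding k_def[symmetric] by (metis Suc_eq_plus1 Suc_n_not_le_n not_le_imp_less)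
  ultimately show thesis using that by blast
qed

lemma phi2_dyadic_unique:
  fixes x :: nat
  assumes "7 * 2 ^ k \<le> x" "x < 7 * 2 ^ (k + 1)" "7 * 2 ^ l \<le> x" "x < 7 * 2 ^ (l + 1)"
  shows "k = l"
proof -
  have "(2::nat) ^ k < 2 ^ (l + 1)" "(2::nat) ^ l < 2 ^ (k + 1)" using assms by linarith+
  then have "k < l + 1" "l < k + 1" by (simp_all only: power_strict_increasing_iff one_less_numeral_iff semiring_norm)
  then show ?thesis by simp
qed

lemma phi2_last_branch:
  fixes x :: nat
  assumes "30 \<le> x"
  shows "\<not> (x < 56 \<or> (\<exists>n\<ge>2. 7 * 2 ^ (2 * n) \<le> x \<and> x < 7 * 2 ^ (2 * n + 1)))
    \<longleftrightarrow> (\<exists>n\<ge>2. 7 * 2 ^ (2 * n - 1) \<le> x \<and> x < 7 * 2 ^ (2 * n))"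
proof
  assume L: "\<not> (x < 56 \<or> (\<exists>n\<ge>2. 7 * 2 ^ (2 * n) \<le> x \<and> x < 7 * 2 ^ (2 * n + 1)))"
  then obtain k where k: "3 \<le> k" "7 * 2 ^ k \<le> x" "x < 7 * 2 ^ (k + 1)"
    using phi2_dyadic_interval by (metis not_le)
  have "odd k"
  proof
    assume "even k"
    then obtain n where n: "k = 2 * n" by (rule evenE)
    moreover have "2 \<le> n" using k n by simp
    ultimately show False using L k by blast
  qed
  then obtain m where m: "k = 2 * m + 1" by (rule oddE)
  with k have "2 \<le> m + 1" "7 * 2 ^ (2 * (m + 1) - 1) \<le> x" "x < 7 * 2 ^ (2 * (m + 1))"
    by simp_all
  then show "\<exists>n\<ge>2. 7 * 2 ^ (2 * n - 1) \<le> x \<and> x < 7 * 2 ^ (2 * n)" by blast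
next
  assume "\<exists>n\<ge>2. 7 * 2 ^ (2 * n - 1) \<le> x \<and> x < 7 * 2 ^ (2 * n)"
  then obtain n where n: "2 \<le> n" "7 * 2 ^ (2 * n - 1) \<le> x" "x < 7 * 2 ^ ((2 * n - 1) + 1)"
    by auto
  have "(2::nat) ^ 3 \<le> 2 ^ (2 * n - 1)" using n by (intro power_increasing) auto
  then have "56 \<le> x" using n by simp
  moreover have False if "2 \<le> m" "7 * 2 ^ (2 * m) \<le> x" "x < 7 * 2 ^ (2 * m + 1)" for m
  proof -
    have "2 * m = 2 * n - 1" using phi2_dyadic_unique that n by blast
    then show False using n by presburger
  qed
  ultimately show "\<not> (x < 56 \<or> (\<exists>n\<ge>2. 7 * 2 ^ (2 * n) \<le> x \<and> x < 7 * 2 ^ (2 * n + 1)))"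
    by (meson not_less)
qed

end

theory Submission
  imports Defs
begin

text \<open>For every third pile \<open>c \<le> 2\<close> the P-positions are the graph of an involution \<open>phi c\<close>. From
  \<open>a = 32\<close> on, \<open>phi c a = a \<oplus> c \<oplus> \<sigma>(a)\<close>, where \<open>\<sigma>(a) \<in> {0, 2}\<close> is constant on blocks of four and
  toggles whenever \<open>a\<close> is doubled. Since \<open>\<sigma>\<close> toggles, halving never leads from one graph to
  another; conversely a position off the graph from which no pile can be lowered onto the graph
  has \<open>a\<close> and \<open>b\<close> in the same block of four, so only the two lowest bits matter.\<close>

section \<open>The shift\<close>

text \<open>The cutoff makes the value 0 below 28; from there on the recursion itself is the toggle
  under doubling.\<close>

fun shift :: "nat \<Rightarrow> nat" where
  "shift a = (if a div 2 < 14 then 0 else 2 - shift (a div 2))"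

declare shift.simps [simp del]

lemma shift_cases: "shift a = 0 \<or> shift a = 2"
proof (induction a rule: shift.induct)
  case (1 a)
  then show ?case by (auto simp: shift.simps[of a])
qed

lemma shift_half: "28 \<le> a \<Longrightarrow> shift (a div 2) = 2 - shift a"
  using shift_cases[of "a div 2"] by (subst (2) shift.simps) auto

text \<open>Two unfoldings see \<open>a\<close> only through \<open>a div 4\<close>, because the
  cutoff 28 is a multiple of 4.\<close>

lemma shift_block:
  assumes "a div 4 = b div 4"
  shows "shift a = shift b"
proof -
  have "a div 2 div 2 = b div 2 div 2" using assms by (simp add: div_mult2_eq[symmetric])
  then have "shift (a div 2) = shift (b div 2)" if "28 \<le> a" "28 \<le> b"
    using that by (simp add: shift.simps[of "a div 2"] shift.simps[of "b div 2"])
  moreover have "28 \<le> x \<longleftrightarrow> 7 \<le> x div 4" for x :: nat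
    by (simp add: less_eq_div_iff_mult_less_eq)
  then have "28 \<le> a \<longleftrightarrow> 28 \<le> b" using assms by simp
  ultimately show ?thesis by (auto simp: shift.simps[of a] shift.simps[of b])
qed

text \<open>Halving maps each dyadic interval into the previous one and flips the value, starting
  from 0 on [14, 28).\<close>

lemma shift_dyadic:
  "7 * 2 ^ k \<le> a \<Longrightarrow> a < 7 * 2 ^ (k + 1) \<Longrightarrow> 1 \<le> k \<Longrightarrow> shift a = (if even k then 2 else 0)"
proof (induction k arbitrary: a)
  case (Suc k)
  show ?case
  proof (cases "k = 0")
    case True
    with Suc.prems show ?thesis by (simp add: shift.simps[of a] shift.simps[of "a div 2"])
  next
    case False
    have *: "7 * 2 ^ k \<le> a div 2" "a div 2 < 7 * 2 ^ (k + 1)" using Suc.prems by auto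
    have "(2::nat) ^ 1 \<le> 2 ^ k" using False by (intro power_increasing) auto
    then have "14 \<le> a div 2" using * by simp
    then show ?thesis using Suc.IH[OF *] False by (subst shift.simps) auto
  qed
qed simp

section \<open>Low bits\<close>

lemma xor_div_2: "xor a b div 2 = xor (a div 2) (b div 2)" for a b :: nat
  using drop_bit_xor[of 1 a b] by (simp add: drop_bit_eq_div)

lemma xor_div_4: "t < 4 \<Longrightarrow> xor a t div 4 = a div 4" for a t :: nat
  using drop_bit_xor[of 2 a t] by (simp add: drop_bit_eq_div)

lemma xor_mod_4: "t < 4 \<Longrightarrow> xor a t mod 4 = xor (a mod 4) t" for a t :: nat
  using take_bit_xor[of 2 a t] by (simp add: take_bit_eq_mod)

lemma xor_cancel: "xor a (xor a b) = b" for a b :: nat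
  by (simp flip: xor.assoc)

lemma less_same_block: "x div 4 = y div 4 \<Longrightarrow> x < y \<longleftrightarrow> x mod 4 < y mod 4" for x y :: nat
  by (metis add_less_cancel_left mult_div_mod_eq)

lemma xor_same_block:
  fixes a b :: nat
  assumes "a div 4 = b div 4"
  shows "xor a b < 4"
proof -
  have "xor a b div 4 = xor (a div 4) (b div 4)"
    using drop_bit_xor[of 2 a b] by (simp add: drop_bit_eq_div)
  then show ?thesis using assms by simp
qed

section \<open>The involutions\<close>

text \<open>Row \<open>c\<close> lists the partners of 0 to 31. With this bound, halves of larger
  numbers are at least 16, where rows 0 and 1 already obey the closed form.\<close>

definition phi_table :: "nat \<Rightarrow> nat list" where
  "phi_table c =
    (if c = 0 then
       [0, 2, 1, 3, 4, 5, 8, 9, 6, 7, 12, 13, 10, 11, 14, 15, 16, 17, 18, 19, 20, 21, 22, 23, 24, 25, 26, 27, 30, 31, 28, 29]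
     else if c = 1 then
       [2, 3, 0, 1, 5, 4, 9, 8, 7, 6, 13, 12, 11, 10, 15, 14, 17, 16, 19, 18, 21, 20, 23, 22, 25, 24, 27, 26, 31, 30, 29, 28]
     else
       [1, 0, 2, 4, 3, 6, 5, 7, 8, 9, 10, 11, 12, 13, 18, 19, 20, 21, 14, 15, 16, 17, 26, 27, 28, 29, 22, 23, 24, 25, 30, 31])"

definition phi :: "nat \<Rightarrow> nat \<Rightarrow> nat" where
  "phi c a = (if a < 32 then phi_table c ! a else xor a (xor c (shift a)))"

section \<open>Exhaustive checks below 32\<close>

lemma table_involution:
  "list_all (\<lambda>c. list_all (\<lambda>a. phi_table c ! a < 32 \<and> phi_table c ! (phi_table c ! a) = a) [0..<32])
    [0..<3]"
  by code_simp

lemma table_distinct: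
  "list_all (\<lambda>c. list_all (\<lambda>c'. list_all (\<lambda>a. phi_table c ! a \<noteq> phi_table c' ! a) [0..<32]) [0..<c])
    [0..<3]"
  by code_simp

text \<open>The exception is the empty position, where halving is not a move.\<close>

lemma table_half:
  "list_all (\<lambda>c. list_all (\<lambda>a. phi_table (c div 2) ! (a div 2) = phi_table c ! a div 2 \<longrightarrow>
      a = 0 \<and> phi_table c ! a = 0 \<and> c = 0) [0..<32]) [0..<3]"
  by code_simp

lemma table_move:
  "list_all (\<lambda>c. list_all (\<lambda>a. list_all (\<lambda>b. a < phi_table c ! b \<longrightarrow>
      list_ex (\<lambda>c'. b = phi_table c' ! a) [0..<c] \<or>
      phi_table (c div 2) ! (a div 2) = b div 2) [0..<phi_table c ! a]) [0..<32]) [0..<3]"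
  by code_simp

lemma table_regular:
  "list_all (\<lambda>c. list_all (\<lambda>a. phi_table c ! a = xor a (xor c (shift a))) [16..<32]) [0..<2]"
  by code_simp

section \<open>The involutions on the whole range\<close>

lemma phi_small: "c \<le> 2 \<Longrightarrow> a < 32 \<Longrightarrow> phi c a < 32"
  using table_involution by (auto simp: phi_def list_all_iff)

lemma phi_regular:
  assumes "c \<le> 1" "16 \<le> a"
  shows "phi c a = xor a (xor c (shift a))"
proof (cases "a < 32")
  case True
  then have "c \<in> set [0..<2]" "a \<in> set [16..<32]"
    using assms by (simp_all only: set_upt atLeastLessThan_iff simp_thms) simp
  then show ?thesis using table_regular True unfolding list_all_iff phi_def by metis
qed (simp add: phi_def)

lemma xor_shift_less: "c \<le> 2 \<Longrightarrow> xor c (shift a) < 4"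
proof -
  assume "c \<le> 2"
  then have "c = 0 \<or> c = 1 \<or> c = 2" by auto
  then show ?thesis using shift_cases[of a] by auto
qed

lemma phi_block:
  assumes "c \<le> 2" "32 \<le> a"
  shows "phi c a div 4 = a div 4"
  using assms xor_div_4[OF xor_shift_less] by (simp add: phi_def)

lemma phi_large:
  assumes "c \<le> 2" "32 \<le> a"
  shows "32 \<le> phi c a"
proof -
  have "32 \<le> x \<longleftrightarrow> 8 \<le> x div 4" for x :: nat
    by (simp add: less_eq_div_iff_mult_less_eq)
  then show ?thesis using phi_block[OF assms] assms(2) by simp
qed

text \<open>From 32 on, \<open>phi c\<close> stays within a block of four, where
  \<open>shift\<close> is constant, so the same xor is applied twice.\<close>

lemma phi_involution:
  assumes "c \<le> 2"
  shows "phi c (phi c a) = a"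
proof (cases "a < 32")
  case True
  then have "c \<in> set [0..<3]" "a \<in> set [0..<32]" using assms by auto
  then show ?thesis using table_involution True unfolding list_all_iff phi_def by metis
next
  case False
  then have "shift (phi c a) = shift a" "32 \<le> phi c a"
    using shift_block[OF phi_block] phi_large assms by simp_all
  with False have "phi c (phi c a) = xor (xor a (xor c (shift a))) (xor c (shift a))"
    by (simp add: phi_def)
  then show ?thesis by (simp add: xor.assoc)
qed

lemma phi_distinct:
  assumes "c \<le> 2" "c' < c"
  shows "phi c a \<noteq> phi c' a"
proof (cases "a < 32")
  case True
  then have "c \<in> set [0..<3]" "c' \<in> set [0..<c]" "a \<in> set [0..<32]" using assms by auto
  then show ?thesis using table_distinct True unfolding list_all_iff phi_def by metis
next
  case False
  have "c = c'" if "xor a (xor c (shift a)) = xor a (xor c' (shift a))"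
    using that by (metis xor_cancel xor.commute)
  then show ?thesis using False assms by (auto simp: phi_def)
qed

text \<open>Put \<open>t = shift a\<close>. For large \<open>a\<close>, cancelling
  \<open>a div 2\<close> and \<open>c div 2\<close> would leave \<open>t div 2 = 2 - t\<close>,
  which fails for both \<open>t = 0\<close> and \<open>t = 2\<close>.\<close>

lemma phi_not_half:
  assumes "c \<le> 2" "phi (c div 2) (a div 2) = phi c a div 2"
  shows "a = 0 \<and> phi c a = 0 \<and> c = 0"
proof (cases "a < 32")
  case True
  then have "c \<in> set [0..<3]" "a \<in> set [0..<32]" using assms by auto
  then have "phi_table (c div 2) ! (a div 2) = phi_table c ! a div 2 \<longrightarrow>
      a = 0 \<and> phi_table c ! a = 0 \<and> c = 0"
    using table_half unfolding list_all_iff by blast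
  moreover have "a div 2 < 32" using True by simp
  ultimately show ?thesis using True assms(2) by (simp add: phi_def)
next
  case False
  have "phi (c div 2) (a div 2) = xor (a div 2) (xor (c div 2) (2 - shift a))"
    using False assms(1) by (simp add: phi_regular shift_half)
  moreover have "phi c a div 2 = xor (a div 2) (xor c (shift a) div 2)"
    using False by (simp add: phi_def xor_div_2)
  ultimately have "xor (c div 2) (2 - shift a) = xor c (shift a) div 2"
    using assms(2) by (metis xor_cancel)
  moreover have "c = 0 \<or> c = 1 \<or> c = 2" using assms(1) by auto
  ultimately have False using shift_cases[of a] by auto
  then show ?thesis ..
qed

text \<open>At the highest bit where \<open>d\<close> and \<open>xor c t\<close> differ, the
  inequalities force bit 0 in both \<open>r\<close> and \<open>d\<close>; hence
  \<open>d < xor c t\<close>. If \<open>t = 0\<close>, the third pile can be lowered to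
  \<open>d\<close>. If \<open>t = 2\<close>, then \<open>c < 2\<close>, and halving serves
  \<open>d < 2\<close>, while \<open>d = 2\<close> forces \<open>c = 1\<close> and is served by
  emptying the third pile.\<close>

lemma low_bits_move:
  fixes c r d t :: nat
  assumes "c = 0 \<or> c = 1 \<or> c = 2" "t = 0 \<or> t = 2"
    and "r = 0 \<or> r = 1 \<or> r = 2 \<or> r = 3" "d = 0 \<or> d = 1 \<or> d = 2 \<or> d = 3"
    and "xor r d < xor r (xor c t)" "r < xor (xor r d) (xor c t)"
  shows "(0 < c \<and> d = xor 0 t) \<or> (1 < c \<and> d = xor 1 t) \<or> xor (c div 2) (2 - t) = d div 2"
  using assms by (elim disjE) simp_all

text \<open>The inequalities say that the position is off the graph and neither of the first two
  piles can be lowered onto it. The winning move then lowers the third pile or halves.\<close>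

lemma phi_move:
  assumes "c \<le> 2" "b < phi c a" "a < phi c b"
  shows "(\<exists>c'<c. b = phi c' a) \<or> phi (c div 2) (a div 2) = b div 2"
proof -
  \<comment> \<open>Since \<open>phi c\<close> maps the range below 32 into itself, a pile below 32
    forces the other below 32 as well.\<close>
  consider "a < 32" "b < 32" | "32 \<le> a" "32 \<le> b"
    using phi_small[OF assms(1)] assms(2,3) by (meson less_trans not_less)
  then show ?thesis
  proof cases
    case 1
    then have "c \<in> set [0..<3]" "a \<in> set [0..<32]" "b \<in> set [0..<phi_table c ! a]"
      "a < phi_table c ! b" "a div 2 < 32"
      using assms by (auto simp: phi_def)
    then have "list_ex (\<lambda>c'. b = phi_table c' ! a) [0..<c] \<or>
      phi_table (c div 2) ! (a div 2) = b div 2"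
      using table_move unfolding list_all_iff by blast
    then show ?thesis using 1 \<open>a div 2 < 32\<close> by (auto simp: phi_def list_ex_iff)
  next
    case 2
    define t where "t = shift a"
    define d where "d = xor a b"
    \<comment> \<open>\<open>phi c\<close> keeps blocks, so each inequality bounds one block index
      by the other.\<close>
    have block: "a div 4 = b div 4"
      using phi_block[OF assms(1) 2(1)] phi_block[OF assms(1) 2(2)] assms(2,3) by linarith
    have b: "b = xor a d" unfolding d_def by (simp add: xor_cancel)
    have d: "d < 4" unfolding d_def using block by (rule xor_same_block)
    have e: "xor c t < 4" unfolding t_def using assms(1) by (rule xor_shift_less)
    have phi_a: "phi c a = xor a (xor c t)" and phi_b: "phi c b = xor b (xor c t)"
      using 2 shift_block[OF block] by (simp_all add: phi_def t_def)
    have b_mod: "b mod 4 = xor (a mod 4) d" using xor_mod_4[OF d, of a] b by simp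
    have "phi c a mod 4 = xor (a mod 4) (xor c t)" "phi c b mod 4 = xor (b mod 4) (xor c t)"
      unfolding phi_a phi_b by (rule xor_mod_4[OF e])+
    \<comment> \<open>All the numbers compared lie in one block, so their residues decide the
      order.\<close>
    moreover have "b mod 4 < phi c a mod 4" "a mod 4 < phi c b mod 4"
      using less_same_block assms(2,3) phi_block[OF assms(1)] 2 block by metis+
    ultimately have less: "xor (a mod 4) d < xor (a mod 4) (xor c t)"
      "a mod 4 < xor (xor (a mod 4) d) (xor c t)"
      unfolding b_mod by simp_all
    have "c = 0 \<or> c = 1 \<or> c = 2" using assms(1) by auto
    moreover have "t = 0 \<or> t = 2" unfolding t_def by (rule shift_cases)
    moreover have "a mod 4 = 0 \<or> a mod 4 = 1 \<or> a mod 4 = 2 \<or> a mod 4 = 3" by presburger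
    moreover have "d = 0 \<or> d = 1 \<or> d = 2 \<or> d = 3" using d by auto
    ultimately have "(0 < c \<and> d = xor 0 t) \<or> (1 < c \<and> d = xor 1 t) \<or>
        xor (c div 2) (2 - t) = d div 2"
      using less by (rule low_bits_move)
    then consider c' where "c' < c" "d = xor c' t" | "xor (c div 2) (2 - t) = d div 2"
      by metis
    then show ?thesis
    proof cases
      case (1 c')
      then have "b = phi c' a" using 2 b by (simp add: phi_def t_def)
      then show ?thesis using 1 by blast
    next
      case half: 2
      have "phi (c div 2) (a div 2) = xor (a div 2) (xor (c div 2) (2 - t))"
        using 2 assms(1) by (simp add: phi_regular shift_half t_def)
      then show ?thesis using half b by (simp add: xor_div_2)
    qed
  qed
qed

section \<open>P-positions with three piles\<close>

lemma halve_nim_move_three: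
  "halve_nim_move {#a, b, c#} q \<longleftrightarrow>
    (\<exists>k<a. q = {#k, b, c#}) \<or> (\<exists>k<b. q = {#a, k, c#}) \<or> (\<exists>k<c. q = {#a, b, k#}) \<or>
    (0 < a + b + c \<and> q = {#a div 2, b div 2, c div 2#})"
  (is "_ \<longleftrightarrow> ?R")
proof
  assume "halve_nim_move {#a, b, c#} q"
  then show ?R
  proof cases
    case (remove m k)
    then consider "m = a" | "m = b" | "m = c" by auto
    then show ?thesis
    proof cases
      case 1
      then have "q = {#k, b, c#}" using remove by simp
      then show ?thesis using 1 remove by blast
    next
      case 2
      then have "q = {#a, k, c#}" using remove by (simp add: add_mset_commute)
      then show ?thesis using 2 remove by blast
    next
      case 3
      \<comment> \<open>The third pile is rotated to the front so that its removal
        simplifies.\<close>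
      have "{#a, b, c#} = {#c, a, b#}" by (simp add: add_mset_commute)
      then have "q = {#k, a, b#}" using 3 remove by simp
      then have "q = {#a, b, k#}" by (simp add: add_mset_commute)
      then show ?thesis using 3 remove by blast
    qed
  next
    case halve
    then show ?thesis by auto
  qed
next
  have a: "halve_nim_move {#x, y, z#} {#k, y, z#}" if "k < x" for x y z k
    using halve_nim_move.remove[of x "{#x, y, z#}" k] that by simp
  have "halve_nim_move {#a, b, c#} {#a, k, c#}" if "k < b" for k
    using a[OF that, of a c] by (simp add: add_mset_commute)
  moreover have "halve_nim_move {#a, b, c#} {#a, b, k#}" if "k < c" for k
    using a[OF that, of a b] by (simp add: add_mset_commute)
  moreover have "halve_nim_move {#a, b, c#} {#a div 2, b div 2, c div 2#}" if "0 < a + b + c"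
    using halve_nim_move.halve[of "{#a, b, c#}"] that by auto
  moreover assume ?R
  ultimately show "halve_nim_move {#a, b, c#} q" using a by blast
qed

lemma P_position_three:
  "P_position {#a, b, c#} \<longleftrightarrow>
    (\<forall>k<a. \<not> P_position {#k, b, c#}) \<and> (\<forall>k<b. \<not> P_position {#a, k, c#}) \<and>
    (\<forall>k<c. \<not> P_position {#a, b, k#}) \<and>
    (0 < a + b + c \<longrightarrow> \<not> P_position {#a div 2, b div 2, c div 2#})"
proof -
  have "N_position q \<longleftrightarrow> \<not> P_position q" for q
    by (simp add: P_position_iff_not_N_position)
  then show ?thesis unfolding P_position_iff[of "{#a, b, c#}"] halve_nim_move_three by auto
qed

theorem P_position_iff_phi: "c \<le> 2 \<Longrightarrow> P_position {#a, b, c#} \<longleftrightarrow> b = phi c a"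
proof (induction "a + b + c" arbitrary: a b c rule: less_induct)
  case less
  have "P_position {#k, b, c#} \<longleftrightarrow> b = phi c k" if "k < a" for k
    using less.hyps[of k b c] less.prems that by simp
  moreover have "P_position {#a, k, c#} \<longleftrightarrow> k = phi c a" if "k < b" for k
    using less.hyps[of a k c] less.prems that by simp
  moreover have "P_position {#a, b, k#} \<longleftrightarrow> b = phi k a" if "k < c" for k
    using less.hyps[of a b k] less.prems that by simp
  moreover have "P_position {#a div 2, b div 2, c div 2#} \<longleftrightarrow>
      b div 2 = phi (c div 2) (a div 2)" if "0 < a + b + c"
    using less.hyps[of "a div 2" "b div 2" "c div 2"] less.prems that by linarith
  ultimately have *: "P_position {#a, b, c#} \<longleftrightarrow>
      (\<forall>k<a. b \<noteq> phi c k) \<and> (\<forall>k<b. k \<noteq> phi c a) \<and> (\<forall>k<c. b \<noteq> phi k a) \<and>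
      (0 < a + b + c \<longrightarrow> b div 2 \<noteq> phi (c div 2) (a div 2))"
    unfolding P_position_three[of a b c] by blast
  show ?case
  proof
    assume b: "b = phi c a"
    \<comment> \<open>An involution is injective, so no smaller first pile has the same
      partner.\<close>
    have "b \<noteq> phi c k" if "k < a" for k
      using b that phi_involution[OF less.prems] by (metis less_irrefl)
    moreover have "b \<noteq> phi k a" if "k < c" for k
      using b phi_distinct[OF less.prems that, of a] by simp
    moreover have "b div 2 \<noteq> phi (c div 2) (a div 2)" if "0 < a + b + c"
      using b that phi_not_half[OF less.prems, of a] by auto
    ultimately show "P_position {#a, b, c#}" unfolding * using b by blast
  next
    assume P: "P_position {#a, b, c#}"
    show "b = phi c a"
    proof (rule ccontr)
      assume neq: "b \<noteq> phi c a"
      then have "a \<noteq> phi c b" using phi_involution[OF less.prems] by metis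
      \<comment> \<open>Otherwise lowering the first pile to \<open>phi c b\<close> would reach the
        graph.\<close>
      moreover have "\<not> phi c b < a"
        using P phi_involution[OF less.prems, of b] unfolding * by metis
      moreover have "\<not> phi c a < b" using P unfolding * by blast
      ultimately have "b < phi c a" "a < phi c b" using neq by auto
      \<comment> \<open>For an empty position the halving alternative would read
        \<open>phi 0 0 = 0\<close>, against \<open>b < phi c a\<close>.\<close>
      with phi_move[OF less.prems this] P show False unfolding * by auto
    qed
  qed
qed

section \<open>The closed form for a third pile of size two\<close>

lemma dyadic_interval:
  fixes x :: nat
  assumes "30 \<le> x"
  obtains k where "2 \<le> k" "7 * 2 ^ k \<le> x" "x < 7 * 2 ^ (k + 1)"
proof (cases "x < 56")
  case True
  then show thesis using that[of 2] assms by simp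
next
  case False
  then obtain k where "3 \<le> k" "7 * 2 ^ k \<le> x" "x < 7 * 2 ^ (k + 1)"
    using phi2_dyadic_interval[of x] by auto
  then show thesis using that[of k] by simp
qed

text \<open>The separately listed range from 30 to 55 lies in the interval for \<open>k = 2\<close>,
  so all branches from 30 on merge into the parity of \<open>k\<close>.\<close>

lemma phi2_dyadic:
  assumes "30 \<le> x" "2 \<le> k" "7 * 2 ^ k \<le> x" "x < 7 * 2 ^ (k + 1)"
  shows "phi2 x = xor x (if even k then 0 else 2)"
proof (cases "x < 56")
  case True
  then have "k = 2" using phi2_dyadic_unique[of k x 2] assms by simp
  then show ?thesis using True assms by (simp add: phi2_def)
next
  case False
  have "(\<exists>n\<ge>2. 7 * 2 ^ (2 * n) \<le> x \<and> x < 7 * 2 ^ (2 * n + 1)) \<longleftrightarrow> even k"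
  proof
    assume "\<exists>n\<ge>2. 7 * 2 ^ (2 * n) \<le> x \<and> x < 7 * 2 ^ (2 * n + 1)"
    then show "even k" using phi2_dyadic_unique assms by (metis dvd_triv_left)
  next
    assume "even k"
    then obtain n where n: "k = 2 * n" by (rule evenE)
    \<comment> \<open>\<open>n = 1\<close> would put \<open>x\<close> below 56.\<close>
    moreover have "n \<noteq> 1" using n False assms by auto
    ultimately show "\<exists>n\<ge>2. 7 * 2 ^ (2 * n) \<le> x \<and> x < 7 * 2 ^ (2 * n + 1)"
      using assms by (intro exI[of _ n]) auto
  qed
  then show ?thesis using False by (simp add: phi2_def)
qed

lemma phi_two_eq_phi2: "phi 2 a = phi2 a"
proof (cases "a < 32")
  case True
  then consider "a < 30" | "a = 30" | "a = 31" by linarith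
  then show ?thesis
  proof cases
    case 1
    \<comment> \<open>The list in \<open>phi2\<close> is row 2 without its last two entries, the
      fixed points 30 and 31.\<close>
    then show ?thesis
      using nth_append_left[of a "take 30 (phi_table 2)" "drop 30 (phi_table 2)"]
      by (simp add: phi_def phi2_def phi_table_def)
  qed (simp_all add: phi_def phi2_def phi_table_def)
next
  case False
  then obtain k where k: "2 \<le> k" "7 * 2 ^ k \<le> a" "a < 7 * 2 ^ (k + 1)"
    using dyadic_interval[of a] by auto
  \<comment> \<open>\<open>xor 2 (shift a)\<close> is 0 for even \<open>k\<close> and 2 for odd
    \<open>k\<close>.\<close>
  then show ?thesis using False phi2_dyadic[of a k] shift_dyadic[of k a] by (simp add: phi_def)
qed

lemma floor_log_dyadic:
  assumes "7 * 2 ^ k \<le> a" "a < 7 * 2 ^ (k + 1)"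
  shows "\<lfloor>log 2 (real a / 7)\<rfloor> = int k"
proof -
  have "real (7 * 2 ^ k) \<le> real a" "real a < real (7 * 2 ^ (k + 1))"
    using assms by (simp_all only: of_nat_le_iff of_nat_less_iff)
  then have bounds: "2 ^ k \<le> real a / 7" "real a / 7 < 2 ^ (k + 1)" by simp_all
  moreover have "0 < real a / 7" using bounds(1) by (rule less_le_trans[rotated]) simp
  ultimately show ?thesis
    by (subst floor_log_eq_powr_iff) (simp_all add: powr_add powr_realpow)
qed

theorem theorem19:
  shows "(\<forall>a b :: nat. P_position {#a, b, 2#} \<longleftrightarrow> b = phi2 a) \<and>
    (\<forall>a b :: nat. 30 \<le> a \<longrightarrow> 30 \<le> b \<longrightarrow>
       (P_position {#a, b, 2#} \<longleftrightarrow>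
        real (xor a b) = 1 + (- 1) powi (\<lfloor>log 2 (real a / 7)\<rfloor> + 1)))"
proof (intro conjI allI impI)
  show P: "P_position {#a, b, 2#} \<longleftrightarrow> b = phi2 a" for a b
    by (simp add: P_position_iff_phi phi_two_eq_phi2)
  fix a b :: nat
  assume "30 \<le> a"
  then obtain k where k: "2 \<le> k" "7 * 2 ^ k \<le> a" "a < 7 * 2 ^ (k + 1)"
    by (rule dyadic_interval)
  let ?d = "if even k then 0 else 2 :: nat"
  \<comment> \<open>The integer exponent is a natural number here, so its sign is settled by the
    parity of \<open>k + 1\<close>.\<close>
  have "(- 1) powi (int k + 1) = ((- 1) ^ (k + 1) :: real)"
    using power_int_of_nat[of "- 1 :: real" "k + 1"] by (simp only: of_nat_add of_nat_1)
  then have "1 + (- 1) powi (\<lfloor>log 2 (real a / 7)\<rfloor> + 1) = real ?d"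
    using floor_log_dyadic[OF k(2,3)] by simp
  moreover have "b = phi2 a \<longleftrightarrow> xor a b = ?d"
    unfolding phi2_dyadic[OF \<open>30 \<le> a\<close> k] using xor_cancel[of a b] xor_cancel[of a ?d] by auto
  ultimately show "P_position {#a, b, 2#} \<longleftrightarrow>
      real (xor a b) = 1 + (- 1) powi (\<lfloor>log 2 (real a / 7)\<rfloor> + 1)"
    unfolding P by (simp only: of_nat_eq_iff)
qed

end
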